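(* Let $k,n$ be integers with $0\le k\le n$. If $\mathcal{F}\subseteq 2^{[n]}$ is such that the vertex set of each component of $G_\mathcal{F}$ is a diamond of height at most $k$, then \[ |\mathcal{F}|\le 2^k\binom{n-k}{\lfloor (n-k)/2\rfloor}. \]
   Context: For $\mathcal{F}\subseteq 2^{[n]}$, $G_\mathcal{F}$ is the graph on $\mathcal{F}$ with distinct $A,B$ adjacent iff $A\subseteq B$ or $B\subseteq A$. A diamond is a family $\{X: A\subseteq X\subseteq B\}$ for some $A\subseteq B\subseteq[n]$; its height is $|B|-|A|$. *)

theory Defs
  imports "Graph_Theory.Graph_Theory"
begin

(* A simple undirected graph is represented by its symmetric loop-free digraph: every edge
   {A, B} becomes the two arcs (A, B) and (B, A). *)
definition comparability_graph :: "'a set set \<Rightarrow> 'a set pair_pre_digraph" where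
  "comparability_graph F =
     \<lparr> pverts = F,
       parcs = {(A, B). A \<in> F \<and> B \<in> F \<and> A \<noteq> B \<and> (A \<subseteq> B \<or> B \<subseteq> A)} \<rparr>"

(* The library's connected refers to the underlying undirected graph and requires at least
   one vertex, so a component is never empty. *)
definition components :: "('a, 'b) pre_digraph \<Rightarrow> ('a, 'b) pre_digraph set" where
  "components G = {C. pre_digraph.max_subgraph G connected C}"

(* The ground set [n] is {1..n}. As A is a subset of the finite set B, the subtraction on nat
   does not truncate; A and B are determined by D, and so is the height h. *)
definition diamond_of_height :: "nat \<Rightarrow> nat \<Rightarrow> nat set set \<Rightarrow> bool" where
  "diamond_of_height n h D \<longleftrightarrow>
     (\<exists>A B. A \<subseteq> B \<and> B \<subseteq> {1..n} \<and> D = {X. A \<subseteq> X \<and> X \<subseteq> B} \<and> h = card B - card A)"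

end

theory Submission
  imports Defs
begin

(* A maximal chain of subsets of [n] meets the diamond [A, B] iff every element of A is added
   before every element outside B, which has probability 1 / binomial(n - h, |A|) for a diamond
   of height h.  A chain meets at most one component, so these probabilities add up to at most 1.
   This is Bollobas' set pairs inequality for the pairs (A, [n] - B), proved here by induction on
   the ground set.  It suffices to combine it with
   2^h binomial(n - h, |A|) <= 2^k binomial(n - k, floor((n - k) / 2)). *)

section \<open>The set pairs inequality\<close>

text \<open>The absorption identity for \<open>(a + c) choose a\<close>, inverted: it compares the
  weight of a set pair with its weight after one point has left the second set. For
  \<open>c = 0\<close> and \<open>a > 0\<close> it would fail.\<close>

lemma inverse_binomial_shift:
  assumes "0 < c"
  shows "real c / real ((a + (c - 1)) choose a) = real (a + c) / real ((a + c) choose a)"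
proof -
  obtain d where d: "c = Suc d" using assms gr0_conv_Suc by blast
  have "Suc d * (Suc (a + d) choose a) = Suc (a + d) * ((a + d) choose a)"
    using binomial_absorb_comp[of "Suc (a + d)" a] by (simp add: Suc_diff_le)
  then have "real (Suc d) * real (Suc (a + d) choose a) = real (Suc (a + d)) * real ((a + d) choose a)"
    by (metis of_nat_mult)
  moreover have "0 < (a + d) choose a" "0 < Suc (a + d) choose a"
    by (simp_all add: zero_less_binomial_iff del: binomial_Suc_Suc)
  ultimately show ?thesis
    unfolding d by (simp add: field_simps del: of_nat_Suc binomial_Suc_Suc)
qed

text \<open>Points of \<open>C\<close> lower its cardinality by one, the other points of
  \<open>X - A\<close> leave it unchanged. If \<open>C\<close> is empty, the truncated
  \<open>card C - 1\<close> is harmless because its coefficient is 0.\<close>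

lemma sum_delete_point:
  fixes w :: "nat \<Rightarrow> real"
  assumes "finite X" "A \<subseteq> X" "C \<subseteq> X" "A \<inter> C = {}"
  shows "(\<Sum>x\<in>X - A. w (card (C - {x})))
       = real (card C) * w (card C - 1) + (real (card X) - real (card A) - real (card C)) * w (card C)"
proof -
  have fin: "finite A" "finite C" using assms finite_subset by blast+
  have X: "X - A = C \<union> (X - A - C)" using assms by blast
  have "card (X - A - C) = card X - card A - card C"
    using assms fin by (metis Diff_disjoint X card_Diff_subset le_sup_iff order_refl)
  moreover have "card A + card C \<le> card X"
    using assms fin by (metis card_Un_disjoint card_mono Un_least)
  ultimately have c: "real (card (X - A - C)) = real (card X) - real (card A) - real (card C)"
    by linarith
  have "(\<Sum>x\<in>X - A. w (card (C - {x})))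
      = (\<Sum>x\<in>C. w (card (C - {x}))) + (\<Sum>x\<in>X - A - C. w (card (C - {x})))"
    using assms(1) fin by (subst X, intro sum.union_disjoint) auto
  also have "(\<Sum>x\<in>C. w (card (C - {x}))) = (\<Sum>x\<in>C. w (card C - 1))"
    by (intro sum.cong) auto
  also have "(\<Sum>x\<in>X - A - C. w (card (C - {x}))) = (\<Sum>x\<in>X - A - C. w (card C))"
    by (intro sum.cong) auto
  finally show ?thesis by (simp add: c)
qed

text \<open>For each point \<open>x\<close>, drop the pairs with \<open>x\<close> in
  \<open>A i\<close> and delete \<open>x\<close> from the other \<open>C i\<close>; what remains
  lives on \<open>X - {x}\<close>. Summing the resulting inequalities over all \<open>x\<close>
  counts the weight of every pair exactly \<open>card X\<close> times.\<close>

theorem bollobas_set_pairs: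
  fixes A C :: "'i \<Rightarrow> 'a set"
  assumes "finite X" "finite I"
    and "\<And>i. i \<in> I \<Longrightarrow> A i \<subseteq> X \<and> C i \<subseteq> X \<and> A i \<inter> C i = {}"
    and "\<And>i j. i \<in> I \<Longrightarrow> j \<in> I \<Longrightarrow> i \<noteq> j \<Longrightarrow> A i \<inter> C j \<noteq> {}"
  shows "(\<Sum>i\<in>I. 1 / real ((card (A i) + card (C i)) choose card (A i))) \<le> 1"
  using assms
\<comment> \<open>\<open>A\<close> stays fixed: the pairs that are kept do not have the deleted
  point in their first set.\<close>
proof (induction "card X" arbitrary: X I C)
  case 0
  \<comment> \<open>On an empty ground set no two distinct indices can satisfy the crossing
    condition, so there is at most one summand, and it is at most 1.\<close>
  then have "A i \<inter> C j = {}" if "i \<in> I" "j \<in> I" for i j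
    using that by auto
  then have "i = j" if "i \<in> I" "j \<in> I" for i j
    using 0(5) that by blast
  then have "card I \<le> 1"
    using 0(3) by (simp add: card_le_Suc0_iff_eq)
  moreover have "(\<Sum>i\<in>I. 1 / real ((card (A i) + card (C i)) choose card (A i))) \<le> (\<Sum>i\<in>I. 1)"
    using 0 by (intro sum_mono) auto
  ultimately show ?case by simp
next
  case (Suc n)
  let ?w = "\<lambda>a c. 1 / real ((a + c) choose a)"
  show ?case
  proof (cases "\<exists>i\<in>I. C i = {}")
    case True
    then obtain i where i: "i \<in> I" "C i = {}" by blast
    \<comment> \<open>Any other index \<open>j\<close> would need \<open>A j\<close> to meet the
      empty \<open>C i\<close>.\<close>
    then have "I = {i}" using Suc.prems(4) by blast
    then show ?thesis using i by simp
  next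
    case False
    \<comment> \<open>With \<open>a = card (A i)\<close> and \<open>c = card (C i)\<close>, points
      of \<open>C i\<close> contribute \<open>a + c\<close> times the weight by the absorption
      identity, and points outside both sets contribute \<open>card X - a - c\<close> times. The
      sizes cancel.\<close>
    have wn: "(\<Sum>x\<in>X - A i. ?w (card (A i)) (card (C i - {x}))) = real (card X) * ?w (card (A i)) (card (C i))"
      if i: "i \<in> I" for i
    proof -
      have "0 < card (C i)"
        using False i Suc.prems by (meson card_gt_0_iff finite_subset)
      from inverse_binomial_shift[OF this, of "card (A i)"]
      have "real (card (C i)) * ?w (card (A i)) (card (C i) - 1)
          = (real (card (A i)) + real (card (C i))) * ?w (card (A i)) (card (C i))"
        by simp
      moreover have "(\<Sum>x\<in>X - A i. ?w (card (A i)) (card (C i - {x})))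
          = real (card (C i)) * ?w (card (A i)) (card (C i) - 1)
            + (real (card X) - real (card (A i)) - real (card (C i))) * ?w (card (A i)) (card (C i))"
        using Suc.prems(1,3) i by (intro sum_delete_point) auto
      ultimately show ?thesis by (simp only: left_diff_distrib distrib_right)
    qed
    have "real (card X) * (\<Sum>i\<in>I. ?w (card (A i)) (card (C i)))
        = (\<Sum>i\<in>I. \<Sum>x | x \<in> X \<and> x \<notin> A i. ?w (card (A i)) (card (C i - {x})))"
      by (simp add: sum_distrib_left wn flip: set_diff_eq del: of_nat_add)
    also have "\<dots> = (\<Sum>x\<in>X. \<Sum>i | i \<in> I \<and> x \<notin> A i. ?w (card (A i)) (card (C i - {x})))"
      using Suc.prems by (intro sum.swap_restrict) auto
    also have "\<dots> \<le> (\<Sum>x\<in>X. 1)"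
    proof (rule sum_mono)
      fix x assume x: "x \<in> X"
      show "(\<Sum>i | i \<in> I \<and> x \<notin> A i. ?w (card (A i)) (card (C i - {x}))) \<le> 1"
      proof (rule Suc.hyps(1)[of "X - {x}"])
        show "n = card (X - {x})" using Suc.hyps(2) Suc.prems(1) x by simp
        show "A i \<subseteq> X - {x} \<and> C i - {x} \<subseteq> X - {x} \<and> A i \<inter> (C i - {x}) = {}"
          if "i \<in> {i \<in> I. x \<notin> A i}" for i using Suc.prems(3)[of i] that by blast
        \<comment> \<open>A common point of \<open>A i\<close> and \<open>C j\<close> survives the
          deletion, since \<open>x\<close> is not in \<open>A i\<close>.\<close>
        show "A i \<inter> (C j - {x}) \<noteq> {}"
          if "i \<in> {i \<in> I. x \<notin> A i}" "j \<in> {i \<in> I. x \<notin> A i}" "i \<noteq> j" for i j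
          using Suc.prems(4)[of i j] that by blast
      qed (use Suc.prems in auto)
    qed
    finally have "real (card X) * (\<Sum>i\<in>I. ?w (card (A i)) (card (C i))) \<le> real (card X) * 1"
      by simp
    then show ?thesis
      using Suc.hyps(2) by (subst (asm) mult_le_cancel_left_pos) auto
  qed
qed

section \<open>Families of diamonds\<close>

text \<open>Pascal's rule splits the left side into two coefficients of row \<open>m\<close>, each
  at most the central one. The half \<open>Suc m div 2\<close> is 0 only for
  \<open>m = 0\<close>.\<close>

lemma central_binomial_Suc_le:
  "Suc m choose (Suc m div 2) \<le> 2 * (m choose (m div 2))"
proof (cases "Suc m div 2")
  case (Suc j)
  then show ?thesis
    using binomial_maximum[of m j] binomial_maximum[of m "Suc j"] by simp
qed simp

lemma power2_times_central_binomial_mono: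
  assumes "h \<le> k" "k \<le> n"
  shows "2 ^ h * ((n - h) choose ((n - h) div 2)) \<le> 2 ^ k * ((n - k) choose ((n - k) div 2))"
  using assms
proof (induction k rule: dec_induct)
  case (step k)
  then have nk: "n - k = Suc (n - Suc k)" by simp
  have "2 ^ h * ((n - h) choose ((n - h) div 2)) \<le> 2 ^ k * ((n - k) choose ((n - k) div 2))"
    using step by simp
  also have "\<dots> \<le> 2 ^ k * (2 * ((n - Suc k) choose ((n - Suc k) div 2)))"
    unfolding nk by (intro mult_le_mono2 central_binomial_Suc_le)
  finally show ?case by simp
qed simp

lemma card_interval_subsets:
  assumes "A \<subseteq> B" "finite B"
  shows "card {X. A \<subseteq> X \<and> X \<subseteq> B} = 2 ^ (card B - card A)"
proof -
  have "{X. A \<subseteq> X \<and> X \<subseteq> B} = (\<lambda>Y. A \<union> Y) ` Pow (B - A)"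
  proof (intro equalityI subsetI)
    fix X assume "X \<in> {X. A \<subseteq> X \<and> X \<subseteq> B}"
    then have "X = A \<union> (X - A)" "X - A \<in> Pow (B - A)" by auto
    then show "X \<in> (\<lambda>Y. A \<union> Y) ` Pow (B - A)" by blast
  qed (use assms in auto)
  moreover have "inj_on (\<lambda>Y. A \<union> Y) (Pow (B - A))"
    by (rule inj_onI) blast
  ultimately show ?thesis
    using assms by (simp add: card_image card_Pow card_Diff_subset finite_subset)
qed

lemma sum_power2_height_le:
  fixes A B :: "'i \<Rightarrow> 'a set"
  assumes "finite X" "finite I" "k \<le> card X"
    and AB: "\<And>i. i \<in> I \<Longrightarrow> A i \<subseteq> B i \<and> B i \<subseteq> X"
    and height: "\<And>i. i \<in> I \<Longrightarrow> card (B i) - card (A i) \<le> k"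
    and cross: "\<And>i j. i \<in> I \<Longrightarrow> j \<in> I \<Longrightarrow> i \<noteq> j \<Longrightarrow> \<not> A i \<subseteq> B j"
  shows "(\<Sum>i\<in>I. 2 ^ (card (B i) - card (A i)))
       \<le> 2 ^ k * ((card X - k) choose ((card X - k) div 2))"
proof -
  let ?K = "2 ^ k * ((card X - k) choose ((card X - k) div 2)) :: nat"
  let ?w = "\<lambda>i. 1 / real ((card (A i) + card (X - B i)) choose card (A i))"
  have "real (2 ^ (card (B i) - card (A i))) \<le> real ?K * ?w i" if i: "i \<in> I" for i
  proof -
    let ?h = "card (B i) - card (A i)"
    have fin: "finite (B i)" using AB[OF i] assms(1) finite_subset by blast
    have "card (A i) \<le> card (B i)" "card (B i) \<le> card X"
      using AB[OF i] assms(1) fin by (auto intro: card_mono)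
    moreover have "card (X - B i) = card X - card (B i)"
      using AB[OF i] fin by (simp add: card_Diff_subset)
    \<comment> \<open>The Bollobas weight of the pair \<open>(A i, X - B i)\<close> thus has a
      binomial coefficient of row \<open>card X - ?h\<close> as its denominator.\<close>
    ultimately have m: "card (A i) + card (X - B i) = card X - ?h" by simp
    have "2 ^ ?h * ((card X - ?h) choose card (A i)) \<le> 2 ^ ?h * ((card X - ?h) choose ((card X - ?h) div 2))"
      by (intro mult_le_mono2 binomial_maximum)
    also have "\<dots> \<le> ?K"
      using height[OF i] assms(3) by (rule power2_times_central_binomial_mono)
    finally have "real (2 ^ ?h) * real ((card X - ?h) choose card (A i)) \<le> real ?K"
      by (metis of_nat_mult of_nat_le_iff)
    moreover have "0 < (card X - ?h) choose card (A i)"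
      using m by (metis le_add1 zero_less_binomial)
    ultimately show ?thesis
      unfolding m by (simp add: field_simps)
  qed
  then have "real (\<Sum>i\<in>I. 2 ^ (card (B i) - card (A i))) \<le> (\<Sum>i\<in>I. real ?K * ?w i)"
    unfolding of_nat_sum by (rule sum_mono)
  also have "\<dots> = real ?K * (\<Sum>i\<in>I. ?w i)"
    by (rule sum_distrib_left[symmetric])
  also have "\<dots> \<le> real ?K * 1"
  proof (rule mult_left_mono)
    show "(\<Sum>i\<in>I. ?w i) \<le> 1"
      \<comment> \<open>\<open>A i\<close> meets \<open>X - B j\<close> precisely because
        \<open>A i\<close> is not contained in \<open>B j\<close>.\<close>
      by (rule bollobas_set_pairs[where X = X]) (use assms in \<open>fastforce+\<close>)
  qed simp
  finally show ?thesis by linarith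
qed

section \<open>Components of a comparability graph\<close>

text \<open>In a symmetric digraph weak and strong connectivity agree, so the library's results on
  strong components apply. Components are subgraphs rather than vertex sets, hence maximality
  concerns arcs as well.\<close>

lemma (in sym_digraph) induce_reachable_in_components:
  assumes u: "u \<in> verts G"
  shows "G \<restriction> {v. u \<rightarrow>\<^sup>* v} \<in> components G"
proof -
  let ?H = "G \<restriction> {v. u \<rightarrow>\<^sup>* v}"
  have H: "induced_subgraph ?H G" "strongly_connected ?H"
    using induce_reachable_is_in_sccs[OF u] by auto
  have "max_subgraph connected ?H"
  proof (rule max_subgraphI)
    show "subgraph ?H G" using H by auto
    interpret H: wf_digraph ?H using H(1) by (rule wf_digraphI_induced)
    show "connected ?H"
      using H(2) H.reachable_mk_symmetricI
      unfolding connected_def strongly_connected_def by simp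
  next
    fix H' assume H': "?H \<noteq> H'" "subgraph ?H H'" "subgraph H' G"
    show "\<not> connected H'"
    proof
      assume conn: "connected H'"
      have uH': "u \<in> verts H'" using H'(2) u by (auto simp: subgraph_def)
      \<comment> \<open>A walk in the symmetric closure of \<open>H'\<close> is one in that of
        \<open>G\<close>, and symmetrizing \<open>G\<close> adds no reachability.\<close>
      have "u \<rightarrow>\<^sup>* v" if "v \<in> verts H'" for v
      proof -
        have "u \<rightarrow>\<^sup>*\<^bsub>with_proj (mk_symmetric H')\<^esub> v"
          using conn uH' that by (auto simp: connected_def)
        then have "u \<rightarrow>\<^sup>*\<^bsub>with_proj (mk_symmetric G)\<^esub> v"
          using subgraph_mk_symmetric[OF H'(3)] by (rule pre_digraph.reachable_mono)
        then show ?thesis by (simp add: reachable_mk_symmetric_eq sym_arcs)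
      qed
      then have "verts H' = {v. u \<rightarrow>\<^sup>* v}"
        using H'(2) by (auto simp: subgraph_def)
      then have "subgraph H' ?H"
        using subgraph_induce_subgraphI2[OF H'(3)] by simp
      \<comment> \<open>Being subgraphs of each other, \<open>H'\<close> and \<open>?H\<close> have
        the same vertices and arcs; compatibility makes their tail and head functions agree, so the
        records are equal.\<close>
      with H'(1,2) show False
        by (auto simp: subgraph_def compatible_def intro: pre_digraph.equality)
    qed
  qed
  then show ?thesis by (simp add: components_def)
qed

theorem theorem3p2:
  fixes k n :: nat and F :: "nat set set"
  assumes "k \<le> n"
    and "F \<subseteq> Pow {1..n}"
    and "\<And>C. C \<in> components (with_proj (comparability_graph F)) \<Longrightarrow>
           \<exists>h\<le>k. diamond_of_height n h (verts C)"
  shows "card F \<le> 2 ^ k * ((n - k) choose ((n - k) div 2))"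
proof -
  let ?G = "with_proj (comparability_graph F)"
  interpret pair_sym_digraph "comparability_graph F"
    by unfold_locales (auto simp: comparability_graph_def symmetric_def sym_def)
  have finF: "finite F" using assms(2) finite_subset by blast
  define I where "I = sccs_verts"
  have I: "I = scc_of ` F"
    unfolding I_def sccs_verts_conv_scc_of by (simp add: comparability_graph_def)
  have scc: "scc_of u = {v. u \<rightarrow>\<^sup>*\<^bsub>?G\<^esub> v}" for u
    unfolding scc_of_def using symmetric_reachable[OF sym_arcs] by auto
  have finI: "finite I" using finF by (simp add: I)
  have disj: "pairwise disjnt I"
    using sccs_verts_disjoint by (auto simp: pairwise_def disjnt_def I_def)
  \<comment> \<open>A diamond determines its ends as its intersection and its union, so the
    components themselves can index the set pairs.\<close>
  have AB: "\<Inter>S \<subseteq> \<Union>S \<and> \<Union>S \<subseteq> {1..n} \<and> {X. \<Inter>S \<subseteq> X \<and> X \<subseteq> \<Union>S} = S \<and>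
      card (\<Union>S) - card (\<Inter>S) \<le> k" if "S \<in> I" for S
  proof -
    obtain u where u: "u \<in> F" "S = scc_of u"
      using \<open>S \<in> I\<close> unfolding I by blast
    have "?G \<restriction> S \<in> components ?G"
      unfolding u(2) scc
      by (rule induce_reachable_in_components) (simp add: comparability_graph_def u(1))
    from assms(3)[OF this] obtain A B where S: "A \<subseteq> B" "B \<subseteq> {1..n}"
      "S = {X. A \<subseteq> X \<and> X \<subseteq> B}" "card B - card A \<le> k"
      by (auto simp: diamond_of_height_def)
    then have "\<Inter>S = A" "\<Union>S = B" by blast+
    with S show ?thesis by simp
  qed
  have sub: "S \<subseteq> F" if "S \<in> I" for S
    using sccs_verts_subsets[of S] that by (simp add: I_def comparability_graph_def)
  \<comment> \<open>The bottom of \<open>S\<close> and the top of \<open>T\<close> are members of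
    \<open>F\<close>. If comparable, they are equal or adjacent, which would put them in the same
    component.\<close>
  have cross: "\<not> \<Inter>S \<subseteq> \<Union>T" if ST: "S \<in> I" "T \<in> I" "S \<noteq> T" for S T
  proof
    assume le: "\<Inter>S \<subseteq> \<Union>T"
    have mem: "\<Inter>S \<in> S" "\<Union>T \<in> T" using AB[OF ST(1)] AB[OF ST(2)] by blast+
    moreover have "\<Inter>S \<rightarrow>\<^sup>*\<^bsub>?G\<^esub> \<Union>T"
    proof (cases "\<Inter>S = \<Union>T")
      case True
      moreover have "\<Union>T \<in> pverts (comparability_graph F)"
        using sub mem ST by (auto simp: comparability_graph_def)
      ultimately show ?thesis by simp
    next
      case False
      then have "(\<Inter>S, \<Union>T) \<in> parcs (comparability_graph F)"
        using le sub mem ST by (auto simp: comparability_graph_def)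
      then show ?thesis by (intro reachable_adjI) simp
    qed
    then have "\<Union>T \<rightarrow>\<^sup>*\<^bsub>?G\<^esub> \<Inter>S" using symmetric_reachable[OF sym_arcs] by blast
    ultimately have "\<Union>T \<in> S"
      using ST \<open>\<Inter>S \<rightarrow>\<^sup>*\<^bsub>?G\<^esub> \<Union>T\<close> by (auto simp: I_def sccs_verts_def)
    then show False using disj ST mem by (auto simp: pairwise_def disjnt_def)
  qed
  \<comment> \<open>The components partition \<open>F\<close>, so \<open>card F\<close> is the sum
    of the diamond sizes.\<close>
  have F: "F = \<Union>I"
    using sub in_scc_of_self by (auto simp: I comparability_graph_def)
  have "card F = (\<Sum>S\<in>I. card S)"
    unfolding F using disj finF sub by (intro card_Union_disjoint) (auto intro: finite_subset)
  also have "\<dots> = (\<Sum>S\<in>I. 2 ^ (card (\<Union>S) - card (\<Inter>S)))"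
  proof (rule sum.cong)
    fix S assume S: "S \<in> I"
    then have "finite (\<Union>S)" using AB finite_subset by blast
    then show "card S = 2 ^ (card (\<Union>S) - card (\<Inter>S))"
      using AB[OF S] card_interval_subsets[of "\<Inter>S" "\<Union>S"] by simp
  qed simp
  also have "\<dots> \<le> 2 ^ k * ((card {1..n} - k) choose ((card {1..n} - k) div 2))"
  proof (rule sum_power2_height_le)
    show "\<Inter>S \<subseteq> \<Union>S \<and> \<Union>S \<subseteq> {1..n}" "card (\<Union>S) - card (\<Inter>S) \<le> k"
      if "S \<in> I" for S using AB[OF that] by auto
  qed (use assms(1) finI cross in auto)
  finally show ?thesis by simp
qed

end
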